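(* Let $H$ be a complex Hilbert space and let $a, b \in E(H)$ with $ab = ba$. Then $a$ and $b$ are partially ortho-coexistent.
   Context: $B(H)$ is the algebra of bounded linear operators on $H$, $I$ is the identity operator, and $E(H) = \{a \in B(H) : a = a^*,\ 0 \le a \le I\}$ is the set of effects. Effects $a, b \in E(H)$ are partially ortho-coexistent if there exist $x, y, z \in E(H)$ such that $a = x + y$, $b = x + z$, $x + y + z \in E(H)$ and $yz = 0$. *)

theory Defs
  imports "HOL-Analysis.Analysis"
begin

text \<open>A complex Hilbert space is a (real) Banach space whose scalar multiplication extends to the
  complex numbers and whose norm comes from a complex inner product. The inner product is linear in
  its second argument and conjugate linear in its first. Positive definiteness is contained in
  \<open>cinner_self\<close>, and \<open>1 *\<^sub>C x = x\<close> in \<open>scaleR_scaleC\<close>.\<close>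

class complex_hilbert = banach +
  fixes scaleC :: "complex \<Rightarrow> 'a \<Rightarrow> 'a" (infixr "*\<^sub>C" 75)
    and cinner :: "'a \<Rightarrow> 'a \<Rightarrow> complex"
  assumes scaleC_add_right: "c *\<^sub>C (x + y) = c *\<^sub>C x + c *\<^sub>C y"
    and scaleC_add_left: "(c + d) *\<^sub>C x = c *\<^sub>C x + d *\<^sub>C x"
    and scaleC_scaleC: "c *\<^sub>C d *\<^sub>C x = (c * d) *\<^sub>C x"
    and scaleR_scaleC: "r *\<^sub>R x = complex_of_real r *\<^sub>C x"
    and cinner_commute: "cinner x y = cnj (cinner y x)"
    and cinner_add_right: "cinner x (y + z) = cinner x y + cinner x z"
    and cinner_scaleC_right: "cinner x (c *\<^sub>C y) = c * cinner x y"
    and cinner_self: "cinner x x = complex_of_real ((norm x)\<^sup>2)"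

instantiation complex :: complex_hilbert
begin

definition scaleC_complex :: "complex \<Rightarrow> complex \<Rightarrow> complex" where
  "scaleC_complex c x = c * x"

definition cinner_complex :: "complex \<Rightarrow> complex \<Rightarrow> complex" where
  "cinner_complex x y = cnj x * y"

instance
  by standard
    (auto simp: scaleC_complex_def cinner_complex_def algebra_simps scaleR_conv_of_real
       complex_norm_square[symmetric] complex_mult_cnj simp flip: of_real_power)

end

text \<open>The type \<open>'h \<Rightarrow>\<^sub>L 'h\<close> consists of the bounded real-linear maps.\<close>

definition bounded_operators :: "('h::complex_hilbert \<Rightarrow>\<^sub>L 'h) set" where
  "bounded_operators = {T. \<forall>c x. blinfun_apply T (c *\<^sub>C x) = c *\<^sub>C blinfun_apply T x}"

definition adj :: "('h::complex_hilbert \<Rightarrow>\<^sub>L 'h) \<Rightarrow> ('h \<Rightarrow>\<^sub>L 'h)" where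
  "adj T = (THE S. \<forall>x y. cinner (blinfun_apply T x) y = cinner x (blinfun_apply S y))"

definition operator_le :: "('h::complex_hilbert \<Rightarrow>\<^sub>L 'h) \<Rightarrow> ('h \<Rightarrow>\<^sub>L 'h) \<Rightarrow> bool" where
  "operator_le S T \<longleftrightarrow> (\<forall>x. cinner x (blinfun_apply (T - S) x) \<in> \<real>\<^sub>\<ge>\<^sub>0)"

definition effects :: "('h::complex_hilbert \<Rightarrow>\<^sub>L 'h) set" where
  "effects = {a \<in> bounded_operators. a = adj a \<and> operator_le 0 a \<and> operator_le a id_blinfun}"

definition partially_ortho_coexistent ::
  "('h::complex_hilbert \<Rightarrow>\<^sub>L 'h) \<Rightarrow> ('h \<Rightarrow>\<^sub>L 'h) \<Rightarrow> bool" where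
  "partially_ortho_coexistent a b \<longleftrightarrow>
     (\<exists>x\<in>effects. \<exists>y\<in>effects. \<exists>z\<in>effects.
        a = x + y \<and> b = x + z \<and> x + y + z \<in> effects \<and> y o\<^sub>L z = 0)"

text \<open>The rest of this theory shows that the description in \<open>adj\<close> determines a unique operator
  for every element of \<open>bounded_operators\<close>.\<close>

lemma cinner_add_left: "cinner (x + y) z = cinner x z + cinner y (z::'h::complex_hilbert)"
  by (metis cinner_commute cinner_add_right complex_cnj_add)

lemma cinner_scaleC_left: "cinner (c *\<^sub>C x) y = cnj c * cinner x (y::'h::complex_hilbert)"
  by (metis cinner_commute cinner_scaleC_right complex_cnj_mult)

lemma cinner_scaleR_right: "cinner x (r *\<^sub>R y) = complex_of_real r * cinner x (y::'h::complex_hilbert)"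
  by (simp add: scaleR_scaleC cinner_scaleC_right)

lemma cinner_scaleR_left: "cinner (r *\<^sub>R x) y = complex_of_real r * cinner x (y::'h::complex_hilbert)"
  by (simp add: scaleR_scaleC cinner_scaleC_left)

lemma cinner_diff_right: "cinner x (y - z) = cinner x y - cinner x (z::'h::complex_hilbert)"
  using cinner_add_right[of x "y - z" z] by simp

lemma cinner_minus_right: "cinner x (- y) = - cinner x (y::'h::complex_hilbert)"
  using cinner_scaleR_right[of x "-1" y] by simp

lemma cinner_minus_left: "cinner (- x) y = - cinner x (y::'h::complex_hilbert)"
  using cinner_scaleR_left[of "-1" x y] by simp

lemma norm_add_square:
  "(norm (x + y))\<^sup>2 = (norm x)\<^sup>2 + (norm y)\<^sup>2 + 2 * Re (cinner x (y::'h::complex_hilbert))"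
proof -
  have "Re (cinner (x + y) (x + y)) = Re (cinner x x) + Re (cinner y y) + 2 * Re (cinner x y)"
    using arg_cong[OF cinner_commute[of y x], of Re] by (simp add: cinner_add_left cinner_add_right)
  then show ?thesis by (simp add: cinner_self del: of_real_power)
qed

lemma Re_cinner_le: "Re (cinner x y) \<le> norm x * norm (y::'h::complex_hilbert)"
proof -
  have "(norm (x + y))\<^sup>2 \<le> (norm x + norm y)\<^sup>2"
    by (intro power_mono norm_triangle_ineq norm_ge_zero)
  then show ?thesis using norm_add_square[of x y] by (simp add: power2_sum)
qed

lemma cinner_eqI:
  assumes "\<And>x. cinner x y = cinner x (z::'h::complex_hilbert)"
  shows "y = z"
proof -
  have "cinner (y - z) (y - z) = 0" using assms by (simp add: cinner_diff_right)
  then show ?thesis by (simp add: cinner_self)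
qed

lemma riesz_real:
  fixes f :: "'h::complex_hilbert \<Rightarrow> real"
  assumes "bounded_linear f"
  shows "\<exists>u. \<forall>v. f v = Re (cinner u v)"
proof -
  interpret f: bounded_linear f by fact
  obtain K where K: "\<And>x. \<bar>f x\<bar> \<le> norm x * K" using f.bounded by auto
  define J where "J x = (norm x)\<^sup>2 - 2 * f x" for x
  have J_lower: "- K\<^sup>2 \<le> J x" for x
    using K[of x] sum_squares_ge_zero[of "norm x - K" 0]
    by (simp add: J_def power2_eq_square algebra_simps)
  define m where "m = Inf (range J)"
  have bdd: "bdd_below (range J)" using J_lower unfolding bdd_below_def by blast
  have m_le: "m \<le> J x" for x unfolding m_def by (rule cInf_lower[OF _ bdd]) simp
  have "\<exists>x. J x < m + inverse (real (Suc n))" for n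
  proof -
    have "Inf (range J) < m + inverse (real (Suc n))" by (simp add: m_def)
    then show ?thesis using cInf_lessD[of "range J"] by blast
  qed
  then obtain X where X: "\<And>n. J (X n) < m + inverse (real (Suc n))" by metis
  have J_diff: "(norm (x - y))\<^sup>2 \<le> 2 * (J x - m) + 2 * (J y - m)" for x y
  proof -
    have "(norm (x + y))\<^sup>2 = (norm x)\<^sup>2 + (norm y)\<^sup>2 + 2 * Re (cinner x y)"
      by (rule norm_add_square)
    moreover have "(norm (x - y))\<^sup>2 = (norm x)\<^sup>2 + (norm y)\<^sup>2 - 2 * Re (cinner x y)"
      using norm_add_square[of x "- y"] by (simp add: cinner_minus_right)
    moreover have "4 * J ((1/2) *\<^sub>R (x + y)) = (norm (x + y))\<^sup>2 - 4 * (f x + f y)"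
      by (simp add: J_def f.scaleR f.add power_mult_distrib power_divide add_divide_distrib
          del: scaleR_add_right)
    ultimately show ?thesis using m_le[of "(1/2) *\<^sub>R (x + y)"] by (simp add: J_def)
  qed
  have "Cauchy X"
  proof (rule metric_CauchyI)
    fix e :: real assume "0 < e"
    then have "0 < e\<^sup>2 / 4" by simp
    then obtain N where N: "inverse (real (Suc N)) < e\<^sup>2 / 4" using reals_Archimedean by blast
    have small: "J (X n) - m < e\<^sup>2 / 4" if "n \<ge> N" for n
    proof -
      have "inverse (real (Suc n)) \<le> inverse (real (Suc N))" using that by simp
      then show ?thesis using X[of n] N by linarith
    qed
    show "\<exists>M. \<forall>i\<ge>M. \<forall>j\<ge>M. dist (X i) (X j) < e"
    proof (intro exI allI impI)
      fix i j assume "N \<le> i" "N \<le> j"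
      then have "(norm (X i - X j))\<^sup>2 < e\<^sup>2"
        using J_diff[of "X i" "X j"] small[of i] small[of j] by simp
      then show "dist (X i) (X j) < e"
        using \<open>0 < e\<close> by (simp add: dist_norm power_less_imp_less_base)
    qed
  qed
  then obtain u where u: "X \<longlonglongrightarrow> u" by (auto simp: Cauchy_convergent_iff convergent_def)
  have "(\<lambda>n. J (X n)) \<longlonglongrightarrow> J u"
    unfolding J_def by (intro tendsto_intros f.tendsto u)
  moreover have "(\<lambda>n. m + inverse (real (Suc n))) \<longlonglongrightarrow> m + 0"
    by (intro tendsto_intros LIMSEQ_inverse_real_of_nat)
  ultimately have Ju: "J u \<le> m"
    using LIMSEQ_le[of "\<lambda>n. J (X n)" "J u" "\<lambda>n. m + inverse (real (Suc n))" "m + 0"] X less_imp_le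
    by auto
  have "f v = Re (cinner u v)" for v
  proof -
    define d where "d = Re (cinner u v) - f v"
    have ineq: "0 \<le> 2 * t * d + t\<^sup>2 * (norm v)\<^sup>2" for t
      using m_le[of "u + t *\<^sub>R v"] Ju
      by (simp add: J_def d_def norm_add_square f.add f.scaleR cinner_scaleR_right
          power_mult_distrib algebra_simps)
    define s where "s = 1 + (norm v)\<^sup>2"
    have s: "0 < s" "(norm v)\<^sup>2 < s" by (simp_all add: s_def add_pos_nonneg)
    have "0 \<le> s\<^sup>2 * (2 * (- d / s) * d + (- d / s)\<^sup>2 * (norm v)\<^sup>2)"
      using ineq[of "- d / s"] by simp
    also have "\<dots> = d\<^sup>2 * ((norm v)\<^sup>2 - 2 * s)"
      using s by (simp add: field_simps power2_eq_square)
    finally have "0 \<le> d\<^sup>2 * ((norm v)\<^sup>2 - 2 * s)" .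
    moreover have "(norm v)\<^sup>2 - 2 * s < 0" using s by linarith
    ultimately have "d\<^sup>2 \<le> 0" by (simp add: zero_le_mult_iff)
    then show ?thesis by (simp add: d_def)
  qed
  then show ?thesis by blast
qed

lemma ex_adjoint:
  fixes T :: "'h::complex_hilbert \<Rightarrow>\<^sub>L 'h"
  assumes T: "T \<in> bounded_operators"
  shows "\<exists>S\<in>bounded_operators. \<forall>x y. cinner (blinfun_apply T x) y = cinner x (blinfun_apply S y)"
proof -
  have Re_comm: "Re (cinner x y) = Re (cinner y x)" for x y :: 'h
    using arg_cong[OF cinner_commute[of x y], of Re] by simp
  have "\<exists>u. \<forall>x. Re (cinner (blinfun_apply T x) y) = Re (cinner u x)" for y
  proof (rule riesz_real)
    show "bounded_linear (\<lambda>x. Re (cinner (blinfun_apply T x) y))"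
    proof (rule bounded_linear_intro[where K = "norm T * norm y"])
      fix x
      have "Re (cinner (blinfun_apply T x) y) \<le> norm (blinfun_apply T x) * norm y"
        and "- Re (cinner (blinfun_apply T x) y) \<le> norm (blinfun_apply T x) * norm y"
        using Re_cinner_le[of "blinfun_apply T x" y]
          Re_cinner_le[of "- blinfun_apply T x" y]
        by (simp_all add: cinner_minus_left)
      moreover have "norm (blinfun_apply T x) * norm y \<le> norm T * norm x * norm y"
        by (intro mult_right_mono norm_blinfun) simp
      ultimately show "norm (Re (cinner (blinfun_apply T x) y)) \<le> norm x * (norm T * norm y)"
        by (simp add: abs_le_iff mult_ac)
    qed (simp_all add: blinfun.add_right blinfun.scaleR_right cinner_add_left cinner_scaleR_left)
  qed
  then obtain S where "\<And>y x. Re (cinner (blinfun_apply T x) y) = Re (cinner (S y) x)" by metis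
  then have S_Re: "Re (cinner (blinfun_apply T x) y) = Re (cinner x (S y))" for x y
    using Re_comm by metis
  have S: "cinner (blinfun_apply T x) y = cinner x (S y)" for x y
  proof (rule complex_eqI)
    show "Re (cinner (blinfun_apply T x) y) = Re (cinner x (S y))" by (rule S_Re)
    show "Im (cinner (blinfun_apply T x) y) = Im (cinner x (S y))"
      using S_Re[of "\<i> *\<^sub>C x" y] T by (simp add: bounded_operators_def cinner_scaleC_left)
  qed
  have S_scaleC: "S (c *\<^sub>C y) = c *\<^sub>C S y" for c y
    by (rule cinner_eqI) (metis S cinner_scaleC_right)
  have S_bounded: "bounded_linear S"
  proof (rule bounded_linear_intro[where K = "norm T"])
    show "S (y + z) = S y + S z" for y z
      by (rule cinner_eqI) (metis S cinner_add_right)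
    show "S (r *\<^sub>R y) = r *\<^sub>R S y" for r y
      by (simp add: scaleR_scaleC S_scaleC)
    show "norm (S y) \<le> norm y * norm T" for y
    proof (cases "S y = 0")
      case False
      have "(norm (S y))\<^sup>2 = Re (cinner (S y) (S y))" by (simp add: cinner_self del: of_real_power)
      also have "\<dots> = Re (cinner (blinfun_apply T (S y)) y)" by (simp add: S)
      also have "\<dots> \<le> norm (blinfun_apply T (S y)) * norm y" by (rule Re_cinner_le)
      also have "\<dots> \<le> norm T * norm (S y) * norm y"
        by (intro mult_right_mono norm_blinfun) simp
      finally show ?thesis using False by (simp add: power2_eq_square mult_ac)
    qed simp
  qed
  show ?thesis
  proof (intro bexI allI)
    show "cinner (blinfun_apply T x) y = cinner x (blinfun_apply (Blinfun S) y)" for x y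
      by (simp add: bounded_linear_Blinfun_apply[OF S_bounded] S)
    show "Blinfun S \<in> bounded_operators"
      by (simp add: bounded_operators_def bounded_linear_Blinfun_apply[OF S_bounded] S_scaleC)
  qed
qed

lemma adj_unique:
  assumes "\<And>x y. cinner (blinfun_apply T x) y = cinner x (blinfun_apply S y)"
  shows "adj T = S"
  unfolding adj_def
proof (rule the_equality)
  fix S' assume S': "\<forall>x y. cinner (blinfun_apply T x) y = cinner x (blinfun_apply S' y)"
  show "S' = S"
  proof (rule blinfun_eqI)
    show "blinfun_apply S' y = blinfun_apply S y" for y
      by (rule cinner_eqI) (metis assms S')
  qed
qed (use assms in blast)

lemma cinner_adj:
  assumes "T \<in> bounded_operators"
  shows "cinner (blinfun_apply T x) y = cinner x (blinfun_apply (adj T) y)"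
  using ex_adjoint[OF assms] adj_unique by metis

lemma adj_in_bounded_operators:
  "T \<in> bounded_operators \<Longrightarrow> adj T \<in> bounded_operators"
  using ex_adjoint adj_unique by metis

end

theory Submission
  imports Defs
begin

text \<open>Put \<open>m = (a + b)/2\<close> and \<open>d = (a - b)/2\<close>. The decomposition is that of the scalar case:
  \<open>x = m - \<bar>d\<bar>\<close> is the minimum of \<open>a\<close> and \<open>b\<close>, \<open>y = \<bar>d\<bar> + d\<close>, \<open>z = \<bar>d\<bar> - d\<close>, and
  \<open>y z = \<bar>d\<bar>\<^sup>2 - d\<^sup>2 = 0\<close>. All effect conditions reduce to \<open>\<plusminus>d \<le> \<bar>d\<bar>\<close>, \<open>\<bar>d\<bar> \<le> m\<close> and
  \<open>\<bar>d\<bar> \<le> 1 - m\<close>. The operator \<open>1 - \<bar>d\<bar>\<close> is the norm limit of the iteration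
  \<open>t \<mapsto> (1 - d\<^sup>2 + t\<^sup>2)/2\<close> started at \<open>0\<close>, which is dominated by the scalar iteration
  \<open>\<tau> \<mapsto> (1 + \<tau>\<^sup>2)/2\<close>, and the inequalities are obtained by following invariants along the
  iteration.\<close>

section \<open>Self-adjoint and positive operators\<close>

lemma blinfun_compose_id_left: "id_blinfun o\<^sub>L f = f"
  by (rule blinfun_eqI) simp

lemma blinfun_compose_id_right: "f o\<^sub>L id_blinfun = f"
  by (rule blinfun_eqI) simp

lemma blinfun_compose_commute_apply:
  assumes "f o\<^sub>L g = g o\<^sub>L f"
  shows "blinfun_apply f (blinfun_apply g x) = blinfun_apply g (blinfun_apply f x)"
  by (metis assms blinfun_apply_blinfun_compose)

lemma blinfun_compose_assoc: "(f o\<^sub>L g) o\<^sub>L h = f o\<^sub>L (g o\<^sub>L h)"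
  by (rule blinfun_eqI) simp

interpretation blinfun_compose: bounded_bilinear "(o\<^sub>L)"
  by (rule bounded_bilinear_blinfun_compose)

lemmas compose_simps =
  blinfun_compose.add_left blinfun_compose.add_right
  blinfun_compose.diff_left blinfun_compose.diff_right
  blinfun_compose.minus_left blinfun_compose.minus_right
  blinfun_compose.scaleR_left blinfun_compose.scaleR_right
  blinfun_compose.zero_left blinfun_compose.zero_right
  blinfun_compose_id_left blinfun_compose_id_right

lemma compose_diff_add_commute:
  assumes "f o\<^sub>L g = g o\<^sub>L f"
  shows "(g - f) o\<^sub>L (g + f) = (g o\<^sub>L g) - (f o\<^sub>L f)"
  by (simp add: compose_simps assms)

text \<open>Follows from \<open>cinner_self\<close>. It makes multiplication by a complex scalar
  continuous, so that complex linearity survives limits of operators.\<close>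

lemma norm_scaleC: "norm (c *\<^sub>C x) = cmod c * norm (x::'h::complex_hilbert)"
proof -
  have "complex_of_real ((norm (c *\<^sub>C x))\<^sup>2) = c * cnj c * complex_of_real ((norm x)\<^sup>2)"
    by (simp add: cinner_scaleC_left cinner_scaleC_right mult_ac del: of_real_power flip: cinner_self)
  also have "\<dots> = complex_of_real ((cmod c * norm x)\<^sup>2)"
    by (simp add: power_mult_distrib flip: complex_norm_square)
  finally have "(norm (c *\<^sub>C x))\<^sup>2 = (cmod c * norm x)\<^sup>2" by (simp only: of_real_eq_iff)
  then show ?thesis by (simp add: power2_eq_iff_nonneg)
qed

lemma tendsto_scaleC [tendsto_intros]:
  assumes "(X \<longlongrightarrow> (x::'h::complex_hilbert)) F"
  shows "((\<lambda>n. c *\<^sub>C X n) \<longlongrightarrow> c *\<^sub>C x) F"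
proof -
  have "bounded_linear (\<lambda>x::'h. c *\<^sub>C x)"
    by (rule bounded_linear_intro[where K = "cmod c"])
      (simp_all add: scaleC_add_right scaleR_scaleC scaleC_scaleC norm_scaleC mult.commute)
  then show ?thesis using assms by (rule bounded_linear.tendsto)
qed

text \<open>The real part is enough to work with: for complex-linear operators the imaginary part is
  recovered by multiplying a vector by the imaginary unit.\<close>

definition rinner :: "'h::complex_hilbert \<Rightarrow> 'h \<Rightarrow> real" where
  "rinner x y = Re (cinner x y)"

lemma rinner_simps:
  "rinner x (y + z) = rinner x y + rinner x z"
  "rinner x (y - z) = rinner x y - rinner x z"
  "rinner x (- y) = - rinner x y"
  "rinner x (r *\<^sub>R y) = r * rinner x y"
  "rinner x 0 = 0"
  "rinner x x = (norm x)\<^sup>2"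
  using cinner_diff_right[of x 0 0]
  by (simp_all add: rinner_def cinner_add_right cinner_diff_right cinner_minus_right
      cinner_scaleR_right cinner_self del: of_real_power)

lemma rinner_commute: "rinner x y = rinner y x"
  using arg_cong[OF cinner_commute[of x y], of Re] by (simp add: rinner_def)

text \<open>Polarization, which reduces continuity of \<open>rinner\<close> to continuity of the
  norm.\<close>

lemma rinner_eq: "rinner x y = ((norm (x + y))\<^sup>2 - (norm x)\<^sup>2 - (norm y)\<^sup>2) / 2"
  by (simp add: rinner_def norm_add_square)

lemma tendsto_rinner [tendsto_intros]:
  assumes "(X \<longlongrightarrow> x) F" "(Y \<longlongrightarrow> y) F"
  shows "((\<lambda>n. rinner (X n) (Y n)) \<longlongrightarrow> rinner x y) F"
  unfolding rinner_eq by (intro tendsto_intros assms) simp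

text \<open>This form avoids the definite description in \<open>adj\<close>;
  \<open>selfadjoint_iff_adj\<close> shows that the notion is the same.\<close>

definition selfadjoint :: "('h::complex_hilbert \<Rightarrow>\<^sub>L 'h) \<Rightarrow> bool" where
  "selfadjoint T \<longleftrightarrow> T \<in> bounded_operators \<and>
     (\<forall>x y. rinner (blinfun_apply T x) y = rinner x (blinfun_apply T y))"

lemma selfadjointD:
  "selfadjoint T \<Longrightarrow> rinner (blinfun_apply T x) y = rinner x (blinfun_apply T y)"
  by (simp add: selfadjoint_def)

lemma selfadjoint_cinner:
  assumes "selfadjoint T"
  shows "cinner (blinfun_apply T x) y = cinner x (blinfun_apply T y)"
proof (rule complex_eqI)
  show "Re (cinner (blinfun_apply T x) y) = Re (cinner x (blinfun_apply T y))"
    using selfadjointD[OF assms] by (simp add: rinner_def)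
  \<comment> \<open>Multiplying \<open>x\<close> by the imaginary unit i multiplies both sides by
    -i, and Re(-i z) = Im z.\<close>
  show "Im (cinner (blinfun_apply T x) y) = Im (cinner x (blinfun_apply T y))"
    using selfadjointD[OF assms, of "\<i> *\<^sub>C x" y] assms
    by (simp add: selfadjoint_def bounded_operators_def cinner_scaleC_left rinner_def)
qed

lemma selfadjoint_iff_adj: "selfadjoint T \<longleftrightarrow> T \<in> bounded_operators \<and> T = adj T"
proof
  assume T: "selfadjoint T"
  show "T \<in> bounded_operators \<and> T = adj T"
    using adj_unique[of T T] selfadjoint_cinner[OF T] T by (simp add: selfadjoint_def)
next
  assume "T \<in> bounded_operators \<and> T = adj T"
  then show "selfadjoint T"
    using cinner_adj[of T] by (simp add: selfadjoint_def rinner_def)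
qed

lemma selfadjoint_zero: "selfadjoint 0"
  using scaleR_scaleC[of 0 0] cinner_scaleR_left[of 0] scaleC_add_right[of _ 0 0]
  by (auto simp: selfadjoint_def bounded_operators_def rinner_commute[of 0] rinner_simps)

lemma selfadjoint_id: "selfadjoint id_blinfun"
  by (simp add: selfadjoint_def bounded_operators_def)

lemma selfadjoint_add: "selfadjoint S \<Longrightarrow> selfadjoint T \<Longrightarrow> selfadjoint (S + T)"
  by (simp add: selfadjoint_def bounded_operators_def blinfun.add_left scaleC_add_right
      rinner_commute[of "_ + _"] rinner_simps) (simp add: rinner_commute)

lemma selfadjoint_scaleR: "selfadjoint T \<Longrightarrow> selfadjoint (r *\<^sub>R T)"
  by (simp add: selfadjoint_def bounded_operators_def blinfun.scaleR_left scaleR_scaleC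
      scaleC_scaleC mult.commute)
    (simp add: rinner_simps rinner_commute[of "_ *\<^sub>R _"] flip: scaleR_scaleC,
      metis rinner_commute)

lemma selfadjoint_diff: "selfadjoint S \<Longrightarrow> selfadjoint T \<Longrightarrow> selfadjoint (S - T)"
  using selfadjoint_add[OF _ selfadjoint_scaleR[of T "-1"], of S] by simp

lemma selfadjoint_compose:
  "selfadjoint S \<Longrightarrow> selfadjoint T \<Longrightarrow> S o\<^sub>L T = T o\<^sub>L S \<Longrightarrow> selfadjoint (S o\<^sub>L T)"
  by (simp add: selfadjoint_def bounded_operators_def blinfun_compose_commute_apply[of S T])

lemmas selfadjoint_intros =
  selfadjoint_zero selfadjoint_id selfadjoint_add selfadjoint_diff selfadjoint_scaleR
  selfadjoint_compose

lemma tendsto_blinfun_apply_left: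
  "(X \<longlongrightarrow> T) F \<Longrightarrow> ((\<lambda>n. blinfun_apply (X n) x) \<longlongrightarrow> blinfun_apply T x) F"
  by (intro tendsto_intros)

text \<open>Norm convergence implies pointwise convergence, and both defining conditions are
  pointwise equations between continuous expressions.\<close>

lemma selfadjoint_LIMSEQ:
  assumes X: "X \<longlonglongrightarrow> T" and sa: "\<And>n. selfadjoint (X n)"
  shows "selfadjoint T"
  unfolding selfadjoint_def bounded_operators_def mem_Collect_eq
proof (intro conjI allI)
  note lim = tendsto_blinfun_apply_left[OF X]
  show "blinfun_apply T (c *\<^sub>C x) = c *\<^sub>C blinfun_apply T x" for c x
  proof (rule LIMSEQ_unique[OF lim])
    show "(\<lambda>n. blinfun_apply (X n) (c *\<^sub>C x)) \<longlonglongrightarrow> c *\<^sub>C blinfun_apply T x"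
      using tendsto_scaleC[OF lim] sa by (simp add: selfadjoint_def bounded_operators_def)
  qed
  show "rinner (blinfun_apply T x) y = rinner x (blinfun_apply T y)" for x y
  proof (rule LIMSEQ_unique)
    show "(\<lambda>n. rinner x (blinfun_apply (X n) y)) \<longlonglongrightarrow> rinner x (blinfun_apply T y)"
      by (intro tendsto_intros lim)
    show "(\<lambda>n. rinner x (blinfun_apply (X n) y)) \<longlonglongrightarrow> rinner (blinfun_apply T x) y"
      unfolding selfadjointD[OF sa, symmetric] by (intro tendsto_intros lim)
  qed
qed

section \<open>Quadratic forms and the positive cone\<close>

definition qform :: "('h::complex_hilbert \<Rightarrow>\<^sub>L 'h) \<Rightarrow> 'h \<Rightarrow> real" where
  "qform T x = rinner x (blinfun_apply T x)"

lemma qform_simps: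
  "qform (S + T) x = qform S x + qform T x"
  "qform (S - T) x = qform S x - qform T x"
  "qform (- T) x = - qform T x"
  "qform (r *\<^sub>R T) x = r * qform T x"
  "qform 0 x = 0"
  "qform id_blinfun x = (norm x)\<^sup>2"
  by (simp_all add: qform_def blinfun.add_left blinfun.diff_left blinfun.minus_left
      blinfun.scaleR_left rinner_simps)

definition positive :: "('h::complex_hilbert \<Rightarrow>\<^sub>L 'h) \<Rightarrow> bool" where
  "positive T \<longleftrightarrow> selfadjoint T \<and> (\<forall>x. 0 \<le> qform T x)"

lemma positiveI: "selfadjoint T \<Longrightarrow> (\<And>x. 0 \<le> qform T x) \<Longrightarrow> positive T"
  by (simp add: positive_def)

lemma positive_selfadjoint: "positive T \<Longrightarrow> selfadjoint T"
  by (simp add: positive_def)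

lemma positive_qform: "positive T \<Longrightarrow> 0 \<le> qform T x"
  by (simp add: positive_def)

lemma positive_zero: "positive 0"
  by (simp add: positive_def selfadjoint_zero qform_simps)

lemma positive_id: "positive id_blinfun"
  by (simp add: positive_def selfadjoint_id qform_simps)

lemma positive_add: "positive S \<Longrightarrow> positive T \<Longrightarrow> positive (S + T)"
  by (simp add: positive_def selfadjoint_add qform_simps)

lemma positive_scaleR: "positive T \<Longrightarrow> 0 \<le> r \<Longrightarrow> positive (r *\<^sub>R T)"
  by (simp add: positive_def selfadjoint_scaleR qform_simps)

lemma positive_LIMSEQ:
  assumes X: "X \<longlonglongrightarrow> T" and pos: "\<And>n. positive (X n)"
  shows "positive T"
proof (rule positiveI)
  show "selfadjoint T" using X by (rule selfadjoint_LIMSEQ) (rule positive_selfadjoint[OF pos])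
  fix x
  have "(\<lambda>n. qform (X n) x) \<longlonglongrightarrow> qform T x"
    unfolding qform_def by (intro tendsto_intros X)
  then show "0 \<le> qform T x"
    by (rule LIMSEQ_le_const) (use positive_qform[OF pos] in blast)
qed

text \<open>Moving \<open>Q\<close> across the inner product shows that conjugation by a
  self-adjoint operator keeps a form nonnegative.\<close>

lemma qform_conj:
  "selfadjoint Q \<Longrightarrow> qform (Q o\<^sub>L (T o\<^sub>L Q)) x = qform T (blinfun_apply Q x)"
  by (simp add: qform_def selfadjointD)

lemma qform_square:
  "selfadjoint T \<Longrightarrow> qform (T o\<^sub>L T) x = (norm (blinfun_apply T x))\<^sup>2"
  by (simp add: qform_def rinner_simps flip: selfadjointD)

lemma positive_square: "selfadjoint T \<Longrightarrow> positive (T o\<^sub>L T)"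
  by (simp add: positive_def selfadjoint_compose qform_square)

lemma positive_norm_bound:
  assumes "selfadjoint T" "norm T \<le> r"
  shows "positive (r *\<^sub>R id_blinfun - T)"
proof (rule positiveI)
  show "selfadjoint (r *\<^sub>R id_blinfun - T)" by (intro selfadjoint_intros assms)
  fix x
  have "qform T x \<le> norm x * norm (blinfun_apply T x)"
    unfolding qform_def rinner_def by (rule Re_cinner_le)
  also have "\<dots> \<le> norm x * (r * norm x)"
    by (intro mult_left_mono order_trans[OF norm_blinfun] mult_right_mono assms) simp_all
  finally show "0 \<le> qform (r *\<^sub>R id_blinfun - T) x"
    by (simp add: qform_simps power2_eq_square mult_ac)
qed

text \<open>The order bounds give T^2 \<le> T \<le> 1, and the form of T^2 at \<open>x\<close> is
  the squared norm of T x. This supplies the norm bounds that the iteration requires.\<close>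

lemma norm_le_one_if_positive:
  assumes T: "positive T" and T': "positive (id_blinfun - T)"
  shows "norm T \<le> 1"
proof (rule norm_blinfun_bound)
  fix x
  let ?S = "id_blinfun - T"
  note sa = positive_selfadjoint[OF T] positive_selfadjoint[OF T']
  \<comment> \<open>\<open>T - T\<^sup>2 = (1 - T) T (1 - T) + T (1 - T) T\<close>\<close>
  have "qform T x - qform (T o\<^sub>L T) x = qform (?S o\<^sub>L (T o\<^sub>L ?S)) x + qform (T o\<^sub>L (?S o\<^sub>L T)) x"
    by (simp add: compose_simps qform_simps)
  moreover have "0 \<le> qform (?S o\<^sub>L (T o\<^sub>L ?S)) x" "0 \<le> qform (T o\<^sub>L (?S o\<^sub>L T)) x"
    using qform_conj[OF sa(2)] qform_conj[OF sa(1)] positive_qform[OF T] positive_qform[OF T']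
    by simp_all
  moreover have "qform T x \<le> (norm x)\<^sup>2"
    using positive_qform[OF T', of x] by (simp add: qform_simps)
  ultimately have "(norm (blinfun_apply T x))\<^sup>2 \<le> (norm x)\<^sup>2"
    unfolding qform_square[OF sa(1)] by linarith
  then show "norm (blinfun_apply T x) \<le> 1 * norm x"
    using power2_le_imp_le[OF _ norm_ge_zero] by simp
qed simp

text \<open>For self-adjoint T the number \<open>cinner x (T x)\<close> is real, so the complex
  condition in \<open>operator_le\<close> becomes a sign condition on \<open>qform\<close>.\<close>

lemma effects_iff: "a \<in> effects \<longleftrightarrow> positive a \<and> positive (id_blinfun - a)"
proof -
  have le: "operator_le S T \<longleftrightarrow> positive (T - S)" if "selfadjoint (T - S)" for S T :: "'a \<Rightarrow>\<^sub>L 'a"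
  proof -
    have "cinner x (blinfun_apply (T - S) x) \<in> \<real>\<^sub>\<ge>\<^sub>0 \<longleftrightarrow> 0 \<le> qform (T - S) x" for x
    proof -
      let ?z = "cinner x (blinfun_apply (T - S) x)"
      have "?z = cnj ?z" by (metis cinner_commute selfadjoint_cinner[OF that])
      then have "Im ?z = 0" by (metis Reals_cnj_iff complex_is_Real_iff)
      then show ?thesis by (simp add: complex_nonneg_Reals_iff qform_def rinner_def)
    qed
    then show ?thesis using that by (simp add: operator_le_def positive_def)
  qed
  have "a \<in> effects \<longleftrightarrow> selfadjoint a \<and> operator_le 0 a \<and> operator_le a id_blinfun"
    by (auto simp: effects_def selfadjoint_iff_adj)
  also have "\<dots> \<longleftrightarrow> positive a \<and> positive (id_blinfun - a)"
    using le[of a 0] le[of id_blinfun a]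
    by (auto simp: selfadjoint_diff selfadjoint_id positive_selfadjoint)
  finally show ?thesis .
qed

section \<open>The square root iteration\<close>

text \<open>This is the operator iteration in the extreme case e = 1; its only fixed point is
  1.\<close>

primrec scalar_iter :: "nat \<Rightarrow> real" where
  "scalar_iter 0 = 0"
| "scalar_iter (Suc n) = (1 + (scalar_iter n)\<^sup>2) / 2"

lemma scalar_iter_bounds: "0 \<le> scalar_iter n \<and> scalar_iter n \<le> 1"
proof (induction n)
  case (Suc n)
  then show ?case using power_le_one[of "scalar_iter n" 2] by simp
qed simp

lemma scalar_iter_LIMSEQ: "scalar_iter \<longlonglongrightarrow> 1"
proof -
  \<comment> \<open>The increment equals (1 - \<tau>)^2 / 2.\<close>
  have "scalar_iter n \<le> scalar_iter (Suc n)" for n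
    using zero_le_power2[of "1 - scalar_iter n"] by (simp add: power2_diff)
  then have "incseq scalar_iter" by (rule incseq_SucI)
  then obtain L where L: "scalar_iter \<longlonglongrightarrow> L"
    using incseq_convergent[of scalar_iter 1] scalar_iter_bounds by blast
  have "(\<lambda>n. (1 + (scalar_iter n)\<^sup>2) / 2) \<longlonglongrightarrow> (1 + L\<^sup>2) / 2"
    by (intro tendsto_intros L) simp
  then have "(\<lambda>n. scalar_iter (Suc n)) \<longlonglongrightarrow> (1 + L\<^sup>2) / 2" by simp
  then have "L = (1 + L\<^sup>2) / 2" using LIMSEQ_Suc[OF L] LIMSEQ_unique by blast
  then have "(L - 1)\<^sup>2 = 0" by (simp add: power2_diff)
  then show ?thesis using L by simp
qed

text \<open>A fixed point t satisfies (1 - t)^2 = 1 - e, so 1 - t is a square root of 1 - e.\<close>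

primrec sqrt_iter :: "('h::complex_hilbert \<Rightarrow>\<^sub>L 'h) \<Rightarrow> nat \<Rightarrow> ('h \<Rightarrow>\<^sub>L 'h)" where
  "sqrt_iter e 0 = 0"
| "sqrt_iter e (Suc n) = (1/2) *\<^sub>R (e + (sqrt_iter e n o\<^sub>L sqrt_iter e n))"

text \<open>Each iterate is a polynomial in \<open>e\<close>.\<close>

lemma sqrt_iter_commute:
  assumes "X o\<^sub>L e = e o\<^sub>L X"
  shows "X o\<^sub>L sqrt_iter e n = sqrt_iter e n o\<^sub>L X"
proof (induction n)
  case (Suc n)
  then show ?case
    using assms by (simp add: compose_simps) (metis blinfun_compose_assoc)
qed (simp add: compose_simps)

lemma sqrt_iter_selfadjoint: "selfadjoint e \<Longrightarrow> selfadjoint (sqrt_iter e n)"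
  by (induction n) (simp_all add: selfadjoint_intros)

lemma norm_sqrt_iter:
  assumes "norm e \<le> 1"
  shows "norm (sqrt_iter e n) \<le> scalar_iter n"
proof (induction n)
  case (Suc n)
  let ?t = "sqrt_iter e n"
  have "norm (e + (?t o\<^sub>L ?t)) \<le> norm e + norm (?t o\<^sub>L ?t)" by (rule norm_triangle_ineq)
  also have "\<dots> \<le> 1 + norm ?t * norm ?t" by (intro add_mono assms norm_blinfun_compose)
  also have "\<dots> \<le> 1 + (scalar_iter n)\<^sup>2"
    unfolding power2_eq_square by (intro add_left_mono mult_mono Suc) (use scalar_iter_bounds in simp_all)
  finally show ?case by simp
qed simp

text \<open>Iterates commute with \<open>e\<close>, hence with each other, so each new increment is
  half a difference of squares and factors. The scalar increments satisfy the same recursion with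
  equality and therefore dominate.\<close>

lemma norm_sqrt_iter_diff:
  assumes "norm e \<le> 1"
  shows "norm (sqrt_iter e (Suc n) - sqrt_iter e n) \<le> scalar_iter (Suc n) - scalar_iter n"
proof (induction n)
  case (Suc n)
  let ?t = "sqrt_iter e n" and ?t' = "sqrt_iter e (Suc n)"
  let ?\<tau> = "scalar_iter n" and ?\<tau>' = "scalar_iter (Suc n)"
  have comm: "?t o\<^sub>L ?t' = ?t' o\<^sub>L ?t"
    by (rule sqrt_iter_commute) (rule sqrt_iter_commute[OF refl, symmetric])
  have "sqrt_iter e (Suc (Suc n)) - ?t' = (1/2) *\<^sub>R ((?t' - ?t) o\<^sub>L (?t' + ?t))"
    unfolding compose_diff_add_commute[OF comm]
    by (simp only: sqrt_iter.simps(2) scaleR_diff_right[symmetric] add_diff_cancel_left)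
  then have "norm (sqrt_iter e (Suc (Suc n)) - ?t') = norm ((?t' - ?t) o\<^sub>L (?t' + ?t)) / 2"
    by simp
  also have "\<dots> \<le> norm (?t' - ?t) * norm (?t' + ?t) / 2"
    by (intro divide_right_mono norm_blinfun_compose) simp
  also have "\<dots> \<le> (?\<tau>' - ?\<tau>) * (?\<tau>' + ?\<tau>) / 2"
    by (intro divide_right_mono mult_mono Suc order_trans[OF norm_triangle_ineq] add_mono
        norm_sqrt_iter assms order_trans[OF norm_ge_zero Suc] norm_ge_zero) simp
  also have "\<dots> = scalar_iter (Suc (Suc n)) - ?\<tau>'"
    unfolding scalar_iter.simps(2)[of "Suc n"] scalar_iter.simps(2)[of n]
    by (simp add: power2_eq_square field_simps)
  finally show ?case .
qed (use assms in simp)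

lemma convergent_sqrt_iter:
  assumes "norm e \<le> 1"
  shows "convergent (sqrt_iter e)"
proof -
  have "summable (\<lambda>n. scalar_iter (Suc n) - scalar_iter n)"
    by (rule telescope_summable[OF scalar_iter_LIMSEQ])
  then have "summable (\<lambda>n. sqrt_iter e (Suc n) - sqrt_iter e n)"
    by (rule summable_comparison_test')
      (rule norm_sqrt_iter_diff[OF assms])
  then have "convergent (\<lambda>n. \<Sum>k<n. sqrt_iter e (Suc k) - sqrt_iter e k)"
    by (simp only: summable_iff_convergent)
  \<comment> \<open>The start value 0 makes the telescoped partial sums equal to the
    iterates.\<close>
  then show ?thesis
    by (simp only: sum_lessThan_telescope sqrt_iter.simps(1) diff_zero)
qed

lemma sqrt_iter_fixpoint:
  assumes "sqrt_iter e \<longlonglongrightarrow> t"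
  shows "2 *\<^sub>R t = e + (t o\<^sub>L t)"
proof -
  have "(\<lambda>n. (1/2) *\<^sub>R (e + (sqrt_iter e n o\<^sub>L sqrt_iter e n))) \<longlonglongrightarrow> (1/2) *\<^sub>R (e + (t o\<^sub>L t))"
    by (intro tendsto_intros assms)
  then have "t = (1/2) *\<^sub>R (e + (t o\<^sub>L t))"
    by (intro LIMSEQ_unique[OF LIMSEQ_Suc[OF assms]]) (simp only: sqrt_iter.simps)
  moreover have "2 *\<^sub>R ((1/2) *\<^sub>R T) = T" for T :: "'a \<Rightarrow>\<^sub>L 'a" by simp
  ultimately show ?thesis by metis
qed

lemma sqrt_iter_limit_commute:
  assumes t: "sqrt_iter e \<longlonglongrightarrow> t" and "X o\<^sub>L e = e o\<^sub>L X"
  shows "X o\<^sub>L t = t o\<^sub>L X"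
proof (rule LIMSEQ_unique)
  show "(\<lambda>n. X o\<^sub>L sqrt_iter e n) \<longlonglongrightarrow> (X o\<^sub>L t)" by (intro tendsto_intros t)
  show "(\<lambda>n. X o\<^sub>L sqrt_iter e n) \<longlonglongrightarrow> (t o\<^sub>L X)"
    unfolding sqrt_iter_commute[OF assms(2)] by (intro tendsto_intros t)
qed

lemma sqrt_iter_square:
  assumes "sqrt_iter (id_blinfun - c) \<longlonglongrightarrow> t"
  shows "(id_blinfun - t) o\<^sub>L (id_blinfun - t) = c"
  using sqrt_iter_fixpoint[OF assms] by (simp add: compose_simps scaleR_2 algebra_simps)

text \<open>After scaling, \<open>B\<close> becomes c = s^2 with a self-adjoint \<open>s\<close>
  that commutes with \<open>A\<close>. Then A c = s A s, a conjugate of the positive operator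
  \<open>A\<close>.\<close>

lemma positive_compose:
  assumes A: "positive A" and B: "positive B" and comm: "A o\<^sub>L B = B o\<^sub>L A"
  shows "positive (A o\<^sub>L B)"
proof -
  \<comment> \<open>The summand 1 keeps the denominator positive even for B = 0 and still forces
    norm c \<le> 1.\<close>
  define k where "k = inverse (norm B + 1)"
  have k: "0 < k" unfolding k_def by (simp add: add_nonneg_pos)
  define c where "c = k *\<^sub>R B"
  have c: "positive c" unfolding c_def by (rule positive_scaleR[OF B]) (use k in simp)
  have "norm c = norm B / (norm B + 1)"
    unfolding c_def k_def by (simp add: divide_inverse mult.commute)
  then have "norm c \<le> 1"
    by (simp add: divide_le_eq_1 add_nonneg_pos)
  then have c': "positive (id_blinfun - c)"
    using positive_norm_bound[OF positive_selfadjoint[OF c], of 1] by simp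
  have "norm (id_blinfun - c) \<le> 1"
    by (rule norm_le_one_if_positive[OF c']) (simp add: c)
  then obtain t where t: "sqrt_iter (id_blinfun - c) \<longlonglongrightarrow> t"
    using convergent_sqrt_iter convergent_def by blast
  define s where "s = id_blinfun - t"
  have sa: "selfadjoint s"
    unfolding s_def by (intro selfadjoint_intros selfadjoint_LIMSEQ[OF t]
        sqrt_iter_selfadjoint positive_selfadjoint[OF c'])
  have s_sq: "s o\<^sub>L s = c" unfolding s_def by (rule sqrt_iter_square[OF t])
  have "A o\<^sub>L t = t o\<^sub>L A"
    by (rule sqrt_iter_limit_commute[OF t]) (simp add: c_def compose_simps comm)
  then have "A o\<^sub>L s = s o\<^sub>L A" by (simp add: s_def compose_simps)
  then have "A o\<^sub>L c = s o\<^sub>L (A o\<^sub>L s)" by (metis s_sq blinfun_compose_assoc)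
  then have "qform (A o\<^sub>L c) x = qform A (blinfun_apply s x)" for x
    by (simp add: qform_conj[OF sa])
  then have "0 \<le> k * qform (A o\<^sub>L B) x" for x
    using positive_qform[OF A] by (simp add: c_def compose_simps qform_simps)
  then have "0 \<le> qform (A o\<^sub>L B) x" for x
    using k by (simp add: zero_le_mult_iff)
  then show ?thesis
    by (intro positiveI selfadjoint_compose positive_selfadjoint[OF A] positive_selfadjoint[OF B] comm)
qed


section \<open>The absolute value\<close>

text \<open>The last conclusion is stated for every \<open>m\<close> because it is used for \<open>m\<close> and \<open>1 - m\<close> with
  the same \<open>s\<close>.\<close>
lemma ex_abs_operator:
  assumes le: "positive (id_blinfun - d)" and ge: "positive (id_blinfun + d)"
  obtains s where "s o\<^sub>L s = d o\<^sub>L d" "d o\<^sub>L s = s o\<^sub>L d"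
    "positive (s - d)" "positive (s + d)"
    "\<And>m. positive m \<Longrightarrow> positive (id_blinfun - m) \<Longrightarrow> positive (m - d) \<Longrightarrow> positive (m + d) \<Longrightarrow>
       m o\<^sub>L d = d o\<^sub>L m \<Longrightarrow> positive (m - s)"
proof -
  define e where "e = id_blinfun - (d o\<^sub>L d)"
  have qform_e: "qform e x = (norm x)\<^sup>2 - qform (d o\<^sub>L d) x" for x
    by (simp add: e_def qform_simps)
  \<comment> \<open>Self-adjointness of \<open>d\<close> has to be extracted from that of 1 - d and
    1 + d.\<close>
  have "d = (1/2) *\<^sub>R ((id_blinfun + d) - (id_blinfun - d))"
    by (simp flip: scaleR_2)
  then have d: "selfadjoint d"
    by (metis selfadjoint_scaleR selfadjoint_diff positive_selfadjoint le ge)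
  have "e = (id_blinfun - d) o\<^sub>L (id_blinfun + d)"
    by (simp add: e_def compose_simps)
  moreover have "positive ((id_blinfun - d) o\<^sub>L (id_blinfun + d))"
    by (rule positive_compose[OF le ge]) (simp add: compose_simps)
  ultimately have e: "positive e" by simp
  have norm_e: "norm e \<le> 1"
    by (rule norm_le_one_if_positive[OF e]) (simp add: e_def positive_square d)
  then obtain t where t: "sqrt_iter e \<longlonglongrightarrow> t"
    using convergent_sqrt_iter convergent_def by blast
  define s where "s = id_blinfun - t"
  let ?t = "sqrt_iter e"
  have iter_sa: "selfadjoint (?t n)" for n
    by (rule sqrt_iter_selfadjoint[OF positive_selfadjoint[OF e]])
  have iter_pos: "positive (?t n)" for n
    by (induction n) (simp_all add: positive_zero positive_scaleR positive_add e
        positive_square iter_sa)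
  have comm_e: "X o\<^sub>L e = e o\<^sub>L X" if "X o\<^sub>L d = d o\<^sub>L X" for X
    unfolding e_def using that by (simp add: compose_simps) (metis blinfun_compose_assoc)
  have comm: "X o\<^sub>L ?t n = ?t n o\<^sub>L X" if "X o\<^sub>L d = d o\<^sub>L X" for X n
    by (rule sqrt_iter_commute[OF comm_e[OF that]])
  \<comment> \<open>Used for f = d and f = -d. As f^2 = d^2, the operator w = 1 - f is a fixed point
    of the iteration, and w - t' = (w - t)(w + t)/2 for successive iterates t, t'. Both factors are
    positive and commute.\<close>
  have iter_le: "positive ((id_blinfun - f) - ?t n)"
    if f: "f o\<^sub>L f = d o\<^sub>L d" "f o\<^sub>L d = d o\<^sub>L f" and pos: "positive (id_blinfun - f)" for f n
  proof (induction n)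
    case (Suc n)
    let ?w = "id_blinfun - f"
    have f_sa: "selfadjoint f"
      using selfadjoint_diff[OF selfadjoint_id positive_selfadjoint[OF pos]] by simp
    have ft: "f o\<^sub>L ?t n = ?t n o\<^sub>L f" by (rule comm[OF f(2)])
    have prod: "positive ((?w - ?t n) o\<^sub>L (?w + ?t n))"
      by (rule positive_compose[OF Suc positive_add[OF pos iter_pos]])
        (simp add: compose_simps ft algebra_simps)
    have split: "qform (?w - ?t (Suc n)) x = qform ((?w - ?t n) o\<^sub>L (?w + ?t n)) x / 2" for x
      by (simp add: compose_simps qform_simps ft f(1) qform_e field_simps)
    show ?case
    proof (rule positiveI)
      show "selfadjoint (?w - ?t (Suc n))"
        by (intro selfadjoint_diff selfadjoint_id f_sa iter_sa)
      show "0 \<le> qform (?w - ?t (Suc n)) x" for x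
        unfolding split using positive_qform[OF prod] by simp
    qed
  qed (simp add: pos)
  have s_ge: "positive (s - f)"
    if "f o\<^sub>L f = d o\<^sub>L d" "f o\<^sub>L d = d o\<^sub>L f" "positive (id_blinfun - f)" for f
  proof -
    have "(\<lambda>n. (id_blinfun - f) - ?t n) \<longlonglongrightarrow> (id_blinfun - f) - t" by (intro tendsto_intros t)
    moreover have "(id_blinfun - f) - t = s - f" by (simp add: s_def)
    ultimately have "(\<lambda>n. (id_blinfun - f) - ?t n) \<longlonglongrightarrow> s - f" by (simp only:)
    then show ?thesis by (rule positive_LIMSEQ) (rule iter_le[OF that])
  qed
  \<comment> \<open>Here w = 1 - m satisfies only w \<le> (e + w^2)/2, because d^2 \<le> m^2. The
    goal is w \<le> t in the limit.\<close>
  have s_le: "positive (m - s)"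
    if m: "positive m" "positive (id_blinfun - m)"
      and md: "positive (m - d)" "positive (m + d)" and comm_m: "m o\<^sub>L d = d o\<^sub>L m" for m
  proof -
    let ?w = "id_blinfun - m" and ?\<tau> = scalar_iter
    have m_sa: "selfadjoint m" by (rule positive_selfadjoint[OF m(1)])
    have sq: "positive ((m - d) o\<^sub>L (m + d))"
      by (rule positive_compose[OF md]) (simp add: compose_simps comm_m)
    \<comment> \<open>The excess of w over the iterate is bounded by the scalar error 1 - \<tau>,
      which tends to 0. The initial case is m \<ge> 0.\<close>
    have bound: "positive ((1 - ?\<tau> n) *\<^sub>R id_blinfun - (?w - ?t n))" for n
    proof (induction n)
      case (Suc n)
      let ?r = "(1 - ?\<tau> n) *\<^sub>R id_blinfun - (?w - ?t n)"
      have mt: "m o\<^sub>L ?t n = ?t n o\<^sub>L m" by (rule comm[OF comm_m])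
      have prod: "positive (?r o\<^sub>L (?w + ?t n))"
        by (rule positive_compose[OF Suc positive_add[OF m(2) iter_pos]])
          (simp add: compose_simps mt algebra_simps)
      have tau: "positive (?\<tau> n *\<^sub>R id_blinfun - ?t n)"
        by (rule positive_norm_bound[OF iter_sa norm_sqrt_iter[OF norm_e]])
      \<comment> \<open>With r the previous slack, twice the new slack is r (w + t) + (1 - \<tau>)(m
        + \<tau> - t) + (m^2 - d^2); every summand is positive.\<close>
      have split: "qform ((1 - ?\<tau> (Suc n)) *\<^sub>R id_blinfun - (?w - ?t (Suc n))) x =
          (qform (?r o\<^sub>L (?w + ?t n)) x
           + (1 - ?\<tau> n) * (qform m x + qform (?\<tau> n *\<^sub>R id_blinfun - ?t n) x)
           + qform ((m - d) o\<^sub>L (m + d)) x) / 2" for x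
        by (simp add: compose_simps qform_simps mt comm_m qform_e power2_eq_square field_simps)
      show ?case
      proof (rule positiveI)
        show "selfadjoint ((1 - ?\<tau> (Suc n)) *\<^sub>R id_blinfun - (?w - ?t (Suc n)))"
          by (intro selfadjoint_diff selfadjoint_scaleR selfadjoint_id m_sa iter_sa)
        show "0 \<le> qform ((1 - ?\<tau> (Suc n)) *\<^sub>R id_blinfun - (?w - ?t (Suc n))) x" for x
          unfolding split using scalar_iter_bounds[of n]
          by (intro divide_nonneg_nonneg add_nonneg_nonneg mult_nonneg_nonneg
              positive_qform prod m(1) tau sq) simp_all
      qed
    qed (simp add: m)
    have "(\<lambda>n. (1 - ?\<tau> n) *\<^sub>R id_blinfun - (?w - ?t n)) \<longlonglongrightarrow> (1 - 1) *\<^sub>R id_blinfun - (?w - t)"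
      by (intro tendsto_intros t scalar_iter_LIMSEQ)
    moreover have "(1 - 1) *\<^sub>R id_blinfun - (?w - t) = m - s" by (simp add: s_def algebra_simps)
    ultimately have "(\<lambda>n. (1 - ?\<tau> n) *\<^sub>R id_blinfun - (?w - ?t n)) \<longlonglongrightarrow> m - s" by (simp only:)
    then show ?thesis by (rule positive_LIMSEQ) (rule bound)
  qed
  show thesis
  proof (rule that)
    show "s o\<^sub>L s = d o\<^sub>L d"
      unfolding s_def by (rule sqrt_iter_square) (use t e_def in simp)
    show "d o\<^sub>L s = s o\<^sub>L d"
      unfolding s_def
      using sqrt_iter_limit_commute[OF t comm_e[OF refl]] by (simp add: compose_simps)
    show "positive (s - d)" by (rule s_ge) (use le in simp_all)
    \<comment> \<open>The operator -d has the same square as \<open>d\<close>, so the lower bound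
      applies to it as well.\<close>
    show "positive (s + d)" using s_ge[of "- d"] ge by (simp add: compose_simps)
  qed (rule s_le)
qed

section \<open>Decomposition of two commuting effects\<close>

theorem proposition2p7:
  fixes a b :: "'h::complex_hilbert \<Rightarrow>\<^sub>L 'h"
  assumes "a \<in> effects" and "b \<in> effects"
    and "a o\<^sub>L b = b o\<^sub>L a"
  shows "partially_ortho_coexistent a b"
proof -
  have a: "positive a" "positive (id_blinfun - a)" and b: "positive b" "positive (id_blinfun - b)"
    using assms by (simp_all add: effects_iff)
  define m d where "m = (1/2) *\<^sub>R (a + b)" and "d = (1/2) *\<^sub>R (a - b)"
  have half: "(1/2) *\<^sub>R T + (1/2) *\<^sub>R T = T" for T :: "'h \<Rightarrow>\<^sub>L 'h"
    by (simp flip: scaleR_left_distrib)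
  have a_eq: "a = m + d" and b_eq: "b = m - d"
    using half[of a] half[of b] by (simp_all add: m_def d_def algebra_simps)
  have id_m: "id_blinfun - m = (1/2) *\<^sub>R ((id_blinfun - a) + (id_blinfun - b))"
    using half[of id_blinfun] by (simp add: m_def algebra_simps)
  have m: "positive m" "positive (id_blinfun - m)"
    unfolding id_m unfolding m_def by (intro positive_scaleR positive_add a b; simp)+
  have md: "m o\<^sub>L d = d o\<^sub>L m"
    using assms(3) by (simp add: m_def d_def compose_simps algebra_simps)
  \<comment> \<open>Writing both operators as halves of sums of positive operators verifies -1 \<le>
    d \<le> 1.\<close>
  have "id_blinfun - d = (1/2) *\<^sub>R ((id_blinfun - a) + b + id_blinfun)"
    and "id_blinfun + d = (1/2) *\<^sub>R ((id_blinfun - b) + a + id_blinfun)"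
    using half[of id_blinfun] by (simp_all add: d_def algebra_simps)
  then have "positive (id_blinfun - d)" "positive (id_blinfun + d)"
    by (simp_all only:) (intro positive_scaleR positive_add a b positive_id; simp)+
  then obtain s where s: "s o\<^sub>L s = d o\<^sub>L d" "d o\<^sub>L s = s o\<^sub>L d"
      "positive (s - d)" "positive (s + d)"
    and s_le: "\<And>m. positive m \<Longrightarrow> positive (id_blinfun - m) \<Longrightarrow> positive (m - d) \<Longrightarrow>
      positive (m + d) \<Longrightarrow> m o\<^sub>L d = d o\<^sub>L m \<Longrightarrow> positive (m - s)"
    using ex_abs_operator by blast
  have x: "positive (m - s)"
    by (rule s_le[OF m]) (use a b md in \<open>simp_all add: a_eq b_eq\<close>)
  \<comment> \<open>The bound is applied to 1 - m: subtracting and adding \<open>d\<close> gives 1 -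
    a and 1 - b, and its complement is \<open>m\<close>.\<close>
  have x': "positive ((id_blinfun - m) - s)"
    by (rule s_le) (use a b m md in \<open>simp_all add: a_eq b_eq compose_simps algebra_simps\<close>)
  show ?thesis
    unfolding partially_ortho_coexistent_def
  proof (intro bexI conjI)
    show "a = (m - s) + (s + d)" "b = (m - s) + (s - d)" by (simp_all add: a_eq b_eq)
    show "(s + d) o\<^sub>L (s - d) = 0" by (simp add: compose_simps s)
    \<comment> \<open>The upper bounds come from 1 - (m - s) = (1 - a) + (s + d), then 1 - (s + d) =
      (1 - a) + (m - s), and likewise with \<open>b\<close> for s - d.\<close>
    show "m - s \<in> effects"
      using x positive_add[OF a(2) s(4)] by (simp add: effects_iff a_eq algebra_simps)
    show "s + d \<in> effects"
      using s(4) positive_add[OF a(2) x] by (simp add: effects_iff a_eq algebra_simps)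
    show "s - d \<in> effects"
      using s(3) positive_add[OF b(2) x] by (simp add: effects_iff b_eq algebra_simps)
    \<comment> \<open>The sum is m + s = a + (s - d), and its complement is (1 - m) - s.\<close>
    show "(m - s) + (s + d) + (s - d) \<in> effects"
      using positive_add[OF a(1) s(3)] x' by (simp add: effects_iff a_eq algebra_simps)
  qed
qed

end
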